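(* Let $\boldsymbol{\xi}_1,\ldots,\boldsymbol{\xi}_{d}$ be linearly independent vectors of $\mathbb{R}^d$, $\boldsymbol{\Xi}=[\boldsymbol{\xi}_1\cdots\boldsymbol{\xi}_d]$, $\boldsymbol{\xi}_{d+1}=\sum_{k=1}^d \boldsymbol{\xi}_k$, and $\boldsymbol{\Xi}_{d+1} = [\boldsymbol{\xi}_1\cdots\boldsymbol{\xi}_{d+1}]$. Then, for every $\mathbf{x}\in\mathbb{R}^d$, $$B_{\boldsymbol{\Xi}_{d+1}}(\mathbf{x}) =\sum_{\boldsymbol{\epsilon}\in\{0,1\}^{d+1}}(-1)^{|\boldsymbol{\epsilon}|} \min\left(\boldsymbol{\Xi}^{-1}(\mathbf{x} - \boldsymbol{\Xi}_{d+1}\boldsymbol{\epsilon})\right)_+.$$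
   Context: Here $d\ge1$. For $\mathbf{z}\in\mathbb{R}^d$, $\min(\mathbf{z})_+=\max(\min_{1\le k\le d} z_k,0)$; for $\boldsymbol{\epsilon}\in\{0,1\}^{d+1}$, $|\boldsymbol{\epsilon}|=\epsilon_1+\cdots+\epsilon_{d+1}$. The linear box spline $B_{\boldsymbol{\Xi}_{d+1}}\colon\mathbb{R}^d\to\mathbb{R}$ is the continuous, compactly supported function defined by its Fourier transform (with $\widehat f(\boldsymbol{\omega})=\int_{\mathbb{R}^d} f(\mathbf{x})e^{-\mathrm{i}\boldsymbol{\omega}^T\mathbf{x}}\,d\mathbf{x}$) $$\widehat{B}_{\boldsymbol{\Xi}_{d+1}}(\boldsymbol{\omega}) = |\det \boldsymbol{\Xi}| \prod_{k=1}^{d+1} \frac{1-e^{-\mathrm{i} \boldsymbol{\xi}_{k}^T\boldsymbol{\omega}}}{\mathrm{i}\boldsymbol{\xi}_{k}^T\boldsymbol{\omega}},$$ each factor being extended by continuity (value $1$) where $\boldsymbol{\xi}_k^T\boldsymbol{\omega}=0$. *)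

theory Defs
  imports "HOL-Analysis.Analysis"
begin

definition matrix_of_columns :: "('k \<Rightarrow> real ^ 'n) \<Rightarrow> real ^ 'k ^ 'n" where
  "matrix_of_columns v = (\<chi> i k. v k $ i)"

lemma column_matrix_of_columns [simp]: "column k (matrix_of_columns v) = v k"
  by (simp add: matrix_of_columns_def column_def vec_eq_iff)

(* With d = CARD('n), the d + 1 indices 1, ..., d + 1 are rendered by the type 'n option:
   Some k stands for the index k of one of the d given vectors, and None for d + 1. *)

definition append_sum :: "('n::finite \<Rightarrow> real ^ 'n) \<Rightarrow> 'n option \<Rightarrow> real ^ 'n" where
  "append_sum \<xi> k = (case k of Some j \<Rightarrow> \<xi> j | None \<Rightarrow> (\<Sum>j\<in>UNIV. \<xi> j))"

definition fourier_transform :: "(real ^ 'n \<Rightarrow> real) \<Rightarrow> real ^ 'n \<Rightarrow> complex" where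
  "fourier_transform f \<omega> =
     (LINT x|lborel. complex_of_real (f x) * exp (- \<i> * complex_of_real (\<omega> \<bullet> x)))"

definition box_factor :: "real \<Rightarrow> complex" where
  "box_factor t =
     (if t = 0 then 1
      else (1 - exp (- \<i> * complex_of_real t)) / (\<i> * complex_of_real t))"

definition is_linear_box_spline :: "('n::finite \<Rightarrow> real ^ 'n) \<Rightarrow> (real ^ 'n \<Rightarrow> real) \<Rightarrow> bool" where
  "is_linear_box_spline \<xi> B \<longleftrightarrow>
     continuous_on UNIV B \<and> compact (closure {x. B x \<noteq> 0}) \<and>
     (\<forall>\<omega>. fourier_transform B \<omega> =
        complex_of_real \<bar>det (matrix_of_columns \<xi>)\<bar> *
        (\<Prod>k\<in>UNIV. box_factor (append_sum \<xi> k \<bullet> \<omega>)))"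

(* The argument consists of the d given vectors only; the last direction is their sum.
   The description is only meaningful if exactly one such function exists, as is the case
   for linearly independent vectors. *)
definition linear_box_spline :: "('n::finite \<Rightarrow> real ^ 'n) \<Rightarrow> real ^ 'n \<Rightarrow> real" where
  "linear_box_spline \<xi> = (THE B. is_linear_box_spline \<xi> B)"

definition min_plus :: "real ^ 'n \<Rightarrow> real" where
  "min_plus z = max (Min (range (\<lambda>k. z $ k))) 0"

definition binary_vectors :: "(nat ^ 'k) set" where
  "binary_vectors = {\<epsilon>. \<forall>k. \<epsilon> $ k \<in> {0, 1}}"

end

theory Submission
  imports Defs
begin

text \<open>
  The box spline is defined by its Fourier transform, so the formula follows once two things are
  known: the right-hand side is continuous, has compact support and has the prescribed Fourier
  transform, and at most one function has these properties.

  For the first part, substitute \<open>x = \<Xi> y\<close>.  The Fourier transform picks up the factor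
  \<open>\<bar>det \<Xi>\<bar>\<close> (\<open>integral_lborel_linear\<close>), and the direction vectors become
  the standard basis vectors together with \<open>(1, ..., 1)\<close>.  The positive part of
  \<open>min z - e\<close> is the integral over \<open>t\<close> of the product of the indicators of
  \<open>e \<le> t\<close> and of \<open>t \<le> z\<^sub>k\<close>.  Inserting this into the alternating sum and
  factoring under the integral sign, the differences of neighbouring half-line indicators become
  indicators of unit intervals, and the sum turns into the convolution of the unit cube with the
  diagonal segment (\<open>tube_indicator_expansion\<close>, \<open>has_bochner_integral_tube\<close>).
  This representation shows that the support is bounded, and by Fubini's theorem the transform is
  the product of the one-dimensional factors (\<open>fourier_transform_cube_spline\<close>).

  For the second part, a continuous function of bounded support with vanishing Fourier transform is
  orthogonal to an algebra that contains all plane waves; by the Stone-Weierstrass theorem it is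
  orthogonal to itself and therefore zero (\<open>fourier_null_imp_zero\<close>).
\<close>

section \<open>Linear change of variables\<close>

text \<open>
  Every linear map is a composition of coordinate scalings, coordinate swaps, shears
  \<open>x\<^sub>m \<mapsto> x\<^sub>m + x\<^sub>n\<close> and maps that annihilate a coordinate.
  Both sides of the volume formula are multiplicative under composition, so it is enough to check
  these four kinds.  For swaps and shears the determinant is \<open>\<plusminus>1\<close>, and it
  suffices to see that the volumes of boxes are preserved.
\<close>

lemma measure_linear_image_det:
  fixes f :: "real ^ 'n \<Rightarrow> real ^ 'n"
  assumes "linear f" and "S \<in> lmeasurable"
  shows "f ` S \<in> lmeasurable"
    and "measure lebesgue (f ` S) = \<bar>det (matrix f)\<bar> * measure lebesgue S"
proof -
  define scales where "scales f \<longleftrightarrow> (\<forall>S\<in>lmeasurable. f ` S \<in> lmeasurable \<and>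
      measure lebesgue (f ` S) = \<bar>det (matrix f)\<bar> * measure lebesgue S)"
    for f :: "real ^ 'n \<Rightarrow> real ^ 'n"
  have from_boxes: "scales f"
    if "linear f" "\<bar>det (matrix f)\<bar> = 1"
      and "\<And>a b. cbox a b \<noteq> {} \<Longrightarrow> measure lebesgue (f ` cbox a b) = measure lebesgue (cbox a b)" for f
  proof -
    have "measure lebesgue (f ` cbox a b) = 1 * measure lebesgue (cbox a b)" for a b
      using that(3)[of a b] by (cases "cbox a b = {}") simp_all
    from measure_linear_sufficient[OF that(1) _ this] show ?thesis
      unfolding scales_def that(2) by metis
  qed
  have "scales f"
  proof (rule induct_linear_elementary[OF \<open>linear f\<close>, of scales])
    show "scales (f \<circ> g)" if "linear f" "linear g" "scales f" "scales g" for f g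
      using that unfolding scales_def image_comp [symmetric]
      by (simp add: matrix_compose det_mul abs_mult)
  next
    fix f :: "real ^ 'n \<Rightarrow> real ^ 'n" and i
    assume f: "linear f" and 0: "\<And>x. f x $ i = 0"
    have "row i (matrix f) = 0"
      using 0 by (simp add: row_def matrix_def vec_eq_iff)
    then have "det (matrix f) = 0"
      by (rule det_zero_row(1))
    moreover have "negligible (f ` S)" for S
      using 0 by (intro negligible_subset[OF negligible_standard_hyperplane_cart[where k = i]]) auto
    ultimately show "scales f"
      by (simp add: scales_def negligible_iff_measure)
  next
    fix c :: "'n \<Rightarrow> real"
    have "det (matrix (\<lambda>x. \<chi> i. c i * x $ i) :: real^'n^'n) = prod c UNIV"
      by (subst det_diagonal) (auto simp: matrix_def axis_def)
    then show "scales (\<lambda>x. \<chi> i. c i * x $ i)"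
      by (simp add: scales_def measurable_stretch measure_stretch)
  next
    fix m n :: 'n
    assume "m \<noteq> n"
    let ?\<tau> = "Transposition.transpose m n"
    let ?h = "\<lambda>x :: real^'n. \<chi> i. x $ ?\<tau> i"
    show "scales ?h"
    proof (rule from_boxes)
      show "linear ?h"
        by (rule linearI) (simp_all add: vec_eq_iff)
      have "matrix ?h = (\<chi> i. mat 1 $ ?\<tau> i)"
        by (auto simp: matrix_def mat_def axis_def vec_eq_iff)
      then show "\<bar>det (matrix ?h)\<bar> = 1"
        by (simp add: det_permute_rows permutes_swap_id sign_swap_id \<open>m \<noteq> n\<close>)
    next
      fix a b :: "real ^ 'n"
      assume ne: "cbox a b \<noteq> {}"
      have "?h ` cbox a b = cbox (?h a) (?h b)"
      proof (intro equalityI subsetI)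
        fix y assume y: "y \<in> cbox (?h a) (?h b)"
        have "a $ i \<le> y $ ?\<tau> i \<and> y $ ?\<tau> i \<le> b $ i" for i
          using y[unfolded mem_box_cart, rule_format, of "?\<tau> i"] by simp
        then have "?h y \<in> cbox a b"
          by (simp add: mem_box_cart)
        moreover have "y = ?h (?h y)"
          by (simp add: vec_eq_iff)
        ultimately show "y \<in> ?h ` cbox a b"
          by blast
      qed (auto simp: mem_box_cart)
      moreover have "(\<Prod>i\<in>UNIV. b $ ?\<tau> i - a $ ?\<tau> i) = (\<Prod>i\<in>UNIV. b $ i - a $ i)"
        using prod.permute[OF permutes_swap_id[of m UNIV n], of "\<lambda>i. b $ i - a $ i"] by (simp add: o_def)
      moreover have "cbox (?h a) (?h b) \<noteq> {}"
        using ne calculation(1) by blast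
      ultimately show "measure lebesgue (?h ` cbox a b) = measure lebesgue (cbox a b)"
        using ne by (simp add: content_cbox_cart)
    qed
  next
    fix m n :: 'n
    assume "m \<noteq> n"
    let ?h = "\<lambda>x :: real^'n. \<chi> i. if i = m then x $ m + x $ n else x $ i"
    show "scales ?h"
    proof (rule from_boxes)
      show lin: "linear ?h"
        by (rule linearI) (auto simp: vec_eq_iff algebra_simps)
      have "matrix ?h = (\<chi> k. if k = m then row m (mat 1) + 1 *s row n (mat 1) else row k (mat 1))"
        by (auto simp: matrix_def mat_def axis_def row_def vec_eq_iff)
      then show "\<bar>det (matrix ?h)\<bar> = 1"
        using det_row_operation[OF \<open>m \<noteq> n\<close>, of "mat 1 :: real^'n^'n" 1] by simp
    next
      fix a b :: "real ^ 'n"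
      assume ne: "cbox a b \<noteq> {}"
      \<comment> \<open>The volume of a sheared box is known when the box starts at \<open>0\<close> in direction
        \<open>n\<close>; translations reduce every box to that case.\<close>
      let ?c = "axis n (a $ n) :: real ^ 'n"
      have box: "cbox a b = (+) ?c ` cbox (a - ?c) (b - ?c)"
        by (simp add: cbox_translation[symmetric])
      have "?h (?c + x) = ?h ?c + ?h x" for x
        by (auto simp: vec_eq_iff)
      then have "?h ` cbox a b = (+) (?h ?c) ` ?h ` cbox (a - ?c) (b - ?c)"
        unfolding box image_image by simp
      then have "measure lebesgue (?h ` cbox a b) = measure lebesgue (?h ` cbox (a - ?c) (b - ?c))"
        by (simp only: measure_translation)
      also have "\<dots> = measure lebesgue (cbox (a - ?c) (b - ?c))"
        using ne box by (intro measure_shear_interval[OF \<open>m \<noteq> n\<close>]) auto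
      also have "\<dots> = measure lebesgue (cbox a b)"
        unfolding box by (simp only: measure_translation)
      finally show "measure lebesgue (?h ` cbox a b) = measure lebesgue (cbox a b)" .
    qed
  qed
  then show "f ` S \<in> lmeasurable" "measure lebesgue (f ` S) = \<bar>det (matrix f)\<bar> * measure lebesgue S"
    using \<open>S \<in> lmeasurable\<close> by (auto simp: scales_def)
qed

text \<open>
  A measure that gives every box its volume is Lebesgue measure.  The preimage of a box under
  \<open>A\<close> is its image under the inverse of \<open>A\<close>, whose volume factor the density
  cancels.
\<close>

lemma lborel_eq_density_distr_linear:
  fixes A :: "real ^ 'n ^ 'n"
  assumes "invertible A"
  shows "lborel = density (distr lborel borel ((*v) A)) (\<lambda>_. ennreal \<bar>det A\<bar>)"
proof (rule lborel_eqI)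
  obtain B where AB: "A ** B = mat 1" and BA: "B ** A = mat 1"
    using assms by (auto simp: invertible_def)
  have inv: "A *v (B *v x) = x" "B *v (A *v x) = x" for x
    by (simp_all add: matrix_vector_mul_assoc AB BA)
  have det: "\<bar>det A\<bar> * \<bar>det B\<bar> = 1"
    using arg_cong[OF AB, of det] by (simp add: det_mul flip: abs_mult)
  have meas[measurable]: "(*v) A \<in> borel_measurable borel"
    by (intro borel_measurable_continuous_onI) (simp add: linear_continuous_on matrix_vector_mul_bounded_linear)
  fix l u :: "real ^ 'n"
  assume lu: "\<And>b. b \<in> Basis \<Longrightarrow> l \<bullet> b \<le> u \<bullet> b"
  have pre: "(*v) A -` box l u = (*v) B ` box l u"
  proof (intro equalityI subsetI)
    fix x assume "x \<in> (*v) A -` box l u"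
    then show "x \<in> (*v) B ` box l u"
      using inv by (intro image_eqI[of _ _ "A *v x"]) auto
  qed (auto simp: inv)
  have bm: "(*v) B ` box l u \<in> lmeasurable"
    by (rule measure_linear_image_det(1)) auto
  have mm: "measure lebesgue ((*v) B ` box l u) = \<bar>det B\<bar> * measure lebesgue (box l u)"
    by (subst measure_linear_image_det(2)) auto
  have sb: "(*v) A -` box l u \<in> sets borel"
    using measurable_sets[OF meas, of "box l u"] by simp
  have "emeasure lborel ((*v) A -` box l u) = emeasure lebesgue ((*v) B ` box l u)"
    using sb by (simp flip: pre)
  also have "\<dots> = ennreal (\<bar>det B\<bar> * measure lebesgue (box l u))"
    using mm bm by (simp add: emeasure_eq_measure2)
  finally have *: "emeasure lborel ((*v) A -` box l u) = ennreal (\<bar>det B\<bar> * (\<Prod>b\<in>Basis. (u - l) \<bullet> b))"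
    using lu by (simp add: measure_lborel_box_eq)
  have "emeasure (density (distr lborel borel ((*v) A)) (\<lambda>_. ennreal \<bar>det A\<bar>)) (box l u)
      = ennreal \<bar>det A\<bar> * emeasure lborel ((*v) A -` box l u)"
    by (simp add: emeasure_density_const emeasure_distr)
  also have "\<dots> = ennreal (\<Prod>b\<in>Basis. (u - l) \<bullet> b)"
    unfolding * using det by (simp add: ennreal_mult' [symmetric] mult.assoc[symmetric])
  finally show "emeasure (density (distr lborel borel ((*v) A)) (\<lambda>_. ennreal \<bar>det A\<bar>)) (box l u) =
       ennreal (\<Prod>b\<in>Basis. (u - l) \<bullet> b)" .
qed simp

lemma integral_lborel_linear:
  fixes A :: "real ^ 'n ^ 'n" and g :: "real ^ 'n \<Rightarrow> complex"
  assumes "invertible A" and [measurable]: "g \<in> borel_measurable borel"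
  shows "(LINT x|lborel. g x) = \<bar>det A\<bar> * (LINT y|lborel. g (A *v y))"
proof -
  have meas[measurable]: "(*v) A \<in> borel_measurable borel"
    by (intro borel_measurable_continuous_onI) (simp add: linear_continuous_on matrix_vector_mul_bounded_linear)
  show ?thesis
    by (subst lborel_eq_density_distr_linear[OF assms(1)])
       (simp add: integral_density integral_distr scaleR_conv_of_real)
qed

section \<open>Injectivity of the Fourier transform\<close>

lemma integrable_continuous_bounded_support:
  fixes f :: "'a::euclidean_space \<Rightarrow> 'b::{banach, second_countable_topology}"
  assumes "continuous_on UNIV f" and "bounded {x. f x \<noteq> 0}"
  shows "integrable lborel f"
proof -
  have "integrable lborel (\<lambda>x. indicator (closure {x. f x \<noteq> 0}) x *\<^sub>R f x)"
    using assms by (intro borel_integrable_compact) (auto intro: continuous_on_subset)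
  moreover have "(\<lambda>x. indicator (closure {x. f x \<noteq> 0}) x *\<^sub>R f x) = f"
    using closure_subset[of "{x. f x \<noteq> 0}"] by (auto simp: indicator_def fun_eq_iff)
  ultimately show ?thesis
    by simp
qed

lemma integrable_fourier:
  fixes f :: "real ^ 'n \<Rightarrow> real"
  assumes "continuous_on UNIV f" and "bounded {x. f x \<noteq> 0}"
  shows "integrable lborel (\<lambda>x. complex_of_real (f x) * exp (- \<i> * complex_of_real (\<omega> \<bullet> x)))"
proof (rule integrable_continuous_bounded_support)
  show "continuous_on UNIV (\<lambda>x. complex_of_real (f x) * exp (- \<i> * complex_of_real (\<omega> \<bullet> x)))"
    using assms(1) by (intro continuous_intros)
qed (use assms(2) in simp)

text \<open>
  The kernel of the Fourier transform on continuous functions with bounded support.  It is shown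
  below to be trivial.
\<close>

definition fourier_null :: "(real ^ 'n \<Rightarrow> real) \<Rightarrow> bool" where
  "fourier_null f \<longleftrightarrow> continuous_on UNIV f \<and> bounded {x. f x \<noteq> 0} \<and>
     (\<forall>\<omega>. fourier_transform f \<omega> = 0)"

lemma fourier_transform_add:
  fixes f g :: "real ^ 'n \<Rightarrow> real"
  assumes "continuous_on UNIV f" "bounded {x. f x \<noteq> 0}"
    and "continuous_on UNIV g" "bounded {x. g x \<noteq> 0}"
  shows "fourier_transform (\<lambda>x. f x + g x) \<omega> = fourier_transform f \<omega> + fourier_transform g \<omega>"
  unfolding fourier_transform_def
  using integrable_fourier[OF assms(1,2)] integrable_fourier[OF assms(3,4)]
  by (simp add: ring_distribs)

lemma fourier_transform_cmult:
  "fourier_transform (\<lambda>x. c * f x) \<omega> = complex_of_real c * fourier_transform f \<omega>"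
  unfolding fourier_transform_def by (simp add: mult.assoc)

lemma bounded_support_add:
  fixes f g :: "'a::real_normed_vector \<Rightarrow> real"
  assumes "bounded {x. f x \<noteq> 0}" "bounded {x. g x \<noteq> 0}"
  shows "bounded {x. f x + g x \<noteq> 0}"
  by (rule bounded_subset[of "{x. f x \<noteq> 0} \<union> {x. g x \<noteq> 0}"]) (use assms in auto)

lemma bounded_support_mult:
  fixes f g :: "'a::real_normed_vector \<Rightarrow> real"
  assumes "bounded {x. f x \<noteq> 0}"
  shows "bounded {x. g x * f x \<noteq> 0}"
  by (rule bounded_subset[OF assms]) auto

lemma fourier_null_add:
  "fourier_null f \<Longrightarrow> fourier_null g \<Longrightarrow> fourier_null (\<lambda>x. f x + g x)"
  by (simp add: fourier_null_def fourier_transform_add bounded_support_add continuous_on_add)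

lemma fourier_null_cmult:
  "fourier_null f \<Longrightarrow> fourier_null (\<lambda>x. c * f x)"
  unfolding fourier_null_def fourier_transform_cmult
  by (intro conjI allI bounded_support_mult continuous_intros) simp_all

text \<open>
  Since \<open>2 cos r = exp (\<i> r) + exp (- \<i> r)\<close>, multiplication by a plane wave replaces
  the Fourier transform by a combination of two of its translates, which vanish with it.
\<close>

lemma fourier_null_cos_mult:
  assumes "fourier_null f"
  shows "fourier_null (\<lambda>x. cos (\<eta> \<bullet> x + \<phi>) * f x)"
proof -
  have f: "continuous_on UNIV f" "bounded {x. f x \<noteq> 0}"
    and 0: "\<And>\<omega>. fourier_transform f \<omega> = 0"
    using assms by (auto simp: fourier_null_def)
  have "fourier_transform (\<lambda>x. cos (\<eta> \<bullet> x + \<phi>) * f x) \<omega>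
      = exp (\<i> * \<phi>) / 2 * fourier_transform f (\<omega> - \<eta>)
      + exp (- \<i> * \<phi>) / 2 * fourier_transform f (\<omega> + \<eta>)" for \<omega>
  proof -
    let ?e = "\<lambda>\<omega> x. exp (- \<i> * complex_of_real (\<omega> \<bullet> x))"
    have "complex_of_real (cos (\<eta> \<bullet> x + \<phi>) * f x) * ?e \<omega> x
        = exp (\<i> * \<phi>) / 2 * (complex_of_real (f x) * ?e (\<omega> - \<eta>) x)
        + exp (- \<i> * \<phi>) / 2 * (complex_of_real (f x) * ?e (\<omega> + \<eta>) x)" for x
    proof -
      let ?r = "complex_of_real (\<eta> \<bullet> x + \<phi>)"
      have "exp (\<i> * ?r) * ?e \<omega> x = exp (\<i> * \<phi>) * ?e (\<omega> - \<eta>) x"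
        unfolding exp_add[symmetric] by (simp add: inner_diff_left algebra_simps)
      moreover have "exp (- (\<i> * ?r)) * ?e \<omega> x = exp (- \<i> * \<phi>) * ?e (\<omega> + \<eta>) x"
        unfolding exp_add[symmetric] by (simp add: inner_add_left algebra_simps)
      moreover have "complex_of_real (cos (\<eta> \<bullet> x + \<phi>)) = (exp (\<i> * ?r) + exp (- (\<i> * ?r))) / 2"
        by (simp only: cos_of_real[symmetric] cos_exp_eq)
      ultimately show ?thesis
        by (simp only: of_real_mult) algebra
    qed
    then show ?thesis
      unfolding fourier_transform_def
      by (simp only:) (subst Bochner_Integration.integral_add;
        (intro integrable_mult_right integrable_fourier[OF f])?; simp only: integral_mult_right_zero)
  qed
  then show ?thesis
    unfolding fourier_null_def using f 0
    by (intro conjI allI bounded_support_mult continuous_intros) simp_all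
qed

text \<open>
  The functions that multiply the kernel into itself form an algebra, which contains the constants
  and, by the preceding lemma, all plane waves; hence it separates points, and it approximates
  \<open>f\<close> uniformly on the support of \<open>f\<close>.  Reading the Fourier transform of
  \<open>g * f\<close> at frequency \<open>0\<close> shows that \<open>f\<close> is orthogonal to every
  multiplier \<open>g\<close>.  Hence \<open>f\<close> is orthogonal to itself.
\<close>

lemma fourier_null_imp_zero:
  fixes f :: "real ^ 'n \<Rightarrow> real"
  assumes "fourier_null f"
  shows "f x = 0"
proof -
  have cont: "continuous_on UNIV f" and supp: "bounded {x. f x \<noteq> 0}"
    using assms by (auto simp: fourier_null_def)
  define multiplier where "multiplier g \<longleftrightarrow> continuous_on UNIV g \<and>
      (\<forall>h. fourier_null h \<longrightarrow> fourier_null (\<lambda>x. g x * h x))" for g :: "real ^ 'n \<Rightarrow> real"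
  have mult_int: "(LINT x|lborel. g x * f x) = 0" if "multiplier g" for g
  proof -
    have "fourier_transform (\<lambda>x. g x * f x) 0 = 0"
      using that assms by (auto simp: multiplier_def fourier_null_def)
    then show ?thesis
      by (simp add: fourier_transform_def flip: of_real_mult)
  qed
  have approx: "\<exists>g. multiplier g \<and> (\<forall>x\<in>closure {x. f x \<noteq> 0}. \<bar>f x - g x\<bar> < e)" if "e > 0" for e
  proof (rule Stone_Weierstrass_HOL)
    show "multiplier (\<lambda>x. c)" for c
      by (simp add: multiplier_def fourier_null_cmult)
    show "continuous_on (closure {x. f x \<noteq> 0}) g" if "multiplier g" for g
      using that by (auto simp: multiplier_def intro: continuous_on_subset)
    show "multiplier (\<lambda>x. g x + h x)" if "multiplier g \<and> multiplier h" for g h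
      using that by (auto simp: multiplier_def ring_distribs fourier_null_add intro!: continuous_intros)
    show "multiplier (\<lambda>x. g x * h x)" if "multiplier g \<and> multiplier h" for g h
      using that by (auto simp: multiplier_def mult.assoc intro!: continuous_intros)
    show "continuous_on (closure {x. f x \<noteq> 0}) f"
      using cont by (rule continuous_on_subset) simp
    fix u v :: "real ^ 'n"
    assume *: "u \<in> closure {x. f x \<noteq> 0} \<and> v \<in> closure {x. f x \<noteq> 0} \<and> u \<noteq> v"
    \<comment> \<open>The phase of the wave is \<open>0\<close> at \<open>v\<close> and \<open>pi / 2\<close> at \<open>u\<close>.\<close>
    define \<eta> where "\<eta> = (pi / 2 / (norm (u - v))\<^sup>2) *\<^sub>R (u - v)"
    have "\<eta> \<bullet> u - \<eta> \<bullet> v = pi / 2"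
      using * unfolding inner_diff_right[symmetric] by (simp add: \<eta>_def power2_norm_eq_inner del: inner_diff_right)
    then have "\<eta> \<bullet> u + - (\<eta> \<bullet> v) = pi / 2"
      by simp
    then have "cos (\<eta> \<bullet> u + - (\<eta> \<bullet> v)) \<noteq> cos (\<eta> \<bullet> v + - (\<eta> \<bullet> v))"
      by (simp only:) simp
    moreover have "multiplier (\<lambda>x. cos (\<eta> \<bullet> x + - (\<eta> \<bullet> v)))"
      unfolding multiplier_def by (intro conjI continuous_intros allI impI fourier_null_cos_mult)
    ultimately show "\<exists>g. multiplier g \<and> g u \<noteq> g v"
      by blast
  qed (use that supp in auto)
  have int_abs: "integrable lborel (\<lambda>x. \<bar>f x\<bar>)"
    using integrable_continuous_bounded_support[OF cont supp] by simp
  have int_sq: "integrable lborel (\<lambda>x. f x * f x)"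
    using cont supp by (intro integrable_continuous_bounded_support)
      (auto intro: continuous_intros)
  have le: "(LINT x|lborel. f x * f x) \<le> e * (LINT x|lborel. \<bar>f x\<bar>)" if "e > 0" for e
  proof -
    obtain g where g: "multiplier g" "\<And>x. f x \<noteq> 0 \<Longrightarrow> \<bar>f x - g x\<bar> < e"
      using approx[OF \<open>e > 0\<close>] closure_subset[of "{x. f x \<noteq> 0}"] by blast
    have int_gf: "integrable lborel (\<lambda>x. g x * f x)"
      using g(1) assms unfolding multiplier_def fourier_null_def
      by (intro integrable_continuous_bounded_support) auto
    have "(LINT x|lborel. f x * f x) = (LINT x|lborel. f x * f x - g x * f x)"
      using int_sq int_gf mult_int[OF g(1)] by simp
    also have "\<dots> \<le> (LINT x|lborel. e * \<bar>f x\<bar>)"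
    proof (rule integral_mono)
      fix x
      have "f x * f x - g x * f x \<le> \<bar>f x - g x\<bar> * \<bar>f x\<bar>"
        by (metis abs_ge_self abs_mult left_diff_distrib)
      also have "\<dots> \<le> e * \<bar>f x\<bar>"
        using g(2)[of x] by (cases "f x = 0") (auto intro!: mult_right_mono)
      finally show "f x * f x - g x * f x \<le> e * \<bar>f x\<bar>" .
    qed (use int_sq int_gf int_abs in auto)
    finally show ?thesis
      by simp
  qed
  have "(LINT x|lborel. f x * f x) \<le> 0"
  proof (rule field_le_epsilon)
    fix e :: real assume "e > 0"
    have I: "(LINT x|lborel. \<bar>f x\<bar>) \<ge> 0"
      by simp
    \<comment> \<open>The summand \<open>1\<close> keeps the denominator positive when \<open>f\<close> vanishes.\<close>
    have "(LINT x|lborel. f x * f x) \<le> e / ((LINT x|lborel. \<bar>f x\<bar>) + 1) * (LINT x|lborel. \<bar>f x\<bar>)"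
      using \<open>e > 0\<close> I by (intro le) (simp add: add_nonneg_pos)
    also have "\<dots> = e * ((LINT x|lborel. \<bar>f x\<bar>) / ((LINT x|lborel. \<bar>f x\<bar>) + 1))"
      by simp
    also have "\<dots> \<le> e * 1"
      using \<open>e > 0\<close> I by (intro mult_left_mono divide_le_eq_1[THEN iffD2]) linarith+
    finally show "(LINT x|lborel. f x * f x) \<le> 0 + e"
      by simp
  qed
  then have "(LINT x|lborel. f x * f x) = 0"
    by (simp add: order.antisym)
  then have "AE x in lborel. f x * f x = 0"
    using int_sq by (subst (asm) integral_nonneg_eq_0_iff_AE) auto
  then have "AE x in lborel. f x = 0"
    by simp
  have op: "open {x. f x \<noteq> 0}"
    using cont by (intro open_Collect_neq continuous_on_const)
  have "{x. f x \<noteq> 0} \<in> null_sets lborel"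
    using \<open>AE x in lborel. f x = 0\<close> op by (subst (asm) AE_iff_null) auto
  then have "negligible {x. f x \<noteq> 0}"
    by (simp add: negligible_iff_null_sets null_sets_completionI)
  then have "{x. f x \<noteq> 0} = {}"
    using open_not_negligible[OF op] by blast
  then show ?thesis
    by blast
qed

section \<open>The alternating sum as a convolution\<close>

lemma prod_of_bool:
  "(\<Prod>k\<in>UNIV. of_bool (P k)) = (of_bool (\<forall>k. P k) :: 'a::semidom)" for P :: "'n::finite \<Rightarrow> bool"
  by (cases "\<forall>k. P k") (auto simp: prod_zero_iff)

text \<open>
  The positive part of \<open>min z - e\<close> is the length of the interval from \<open>e\<close> to
  \<open>min z\<close>.  Written as the integral of an indicator that is a product over the coordinates,
  the minimum becomes accessible to the expansion of products.
\<close>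

lemma has_bochner_integral_min_plus:
  fixes z :: "real ^ 'n"
  shows "has_bochner_integral lborel (\<lambda>t. of_bool (e \<le> t) * (\<Prod>k\<in>UNIV. of_bool (t \<le> z $ k)))
     (min_plus (\<chi> k. z $ k - e))"
proof -
  let ?m = "Min (range (\<lambda>k. z $ k))"
  have 1: "of_bool (e \<le> t) * (\<Prod>k\<in>UNIV. of_bool (t \<le> z $ k)) = indicat_real {e..?m} t" for t
  proof -
    have "(\<forall>k. t \<le> z $ k) \<longleftrightarrow> t \<le> ?m"
      by (subst Min_ge_iff) auto
    then show ?thesis
      by (auto simp: prod_of_bool indicator_def)
  qed
  have "Min (range (\<lambda>k. z $ k + - e)) = ?m + - e"
    by (rule Min_add_commute) auto
  then have "min_plus (\<chi> k. z $ k - e) = max (?m - e) 0"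
    by (simp add: min_plus_def)
  also have "\<dots> = measure lborel {e..?m}"
    by (cases "e \<le> ?m") (simp_all del: Min_le_iff Min_ge_iff)
  finally have 2: "min_plus (\<chi> k. z $ k - e) = measure lborel {e..?m}" .
  show ?thesis
    unfolding 1 2 by (rule has_bochner_integral_real_indicator) (auto simp: emeasure_lborel_Icc_eq)
qed

lemma sum_binary_vectors:
  fixes F :: "'k::finite \<Rightarrow> nat \<Rightarrow> real"
  shows "(\<Sum>\<epsilon>\<in>binary_vectors. \<Prod>k\<in>UNIV. F k (\<epsilon> $ k)) = (\<Prod>k\<in>UNIV. F k 0 + F k 1)"
proof -
  have "(\<Prod>k\<in>UNIV. F k 0 + F k 1) = (\<Prod>k\<in>UNIV. \<Sum>e\<in>{0,1}. F k e)"
    by simp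
  also have "\<dots> = (\<Sum>g\<in>PiE UNIV (\<lambda>_. {0,1}). \<Prod>k\<in>UNIV. F k (g k))"
    by (rule prod_sum_PiE) auto
  also have "\<dots> = (\<Sum>\<epsilon>\<in>binary_vectors. \<Prod>k\<in>UNIV. F k (\<epsilon> $ k))"
    by (rule sum.reindex_bij_witness[of _ "vec_nth" "vec_lambda"]) (auto simp: binary_vectors_def PiE_def Pi_def)
  finally show ?thesis ..
qed

lemma prod_option:
  fixes F :: "'n::finite option \<Rightarrow> 'a::comm_monoid_mult"
  shows "(\<Prod>k\<in>UNIV. F k) = F None * (\<Prod>k\<in>UNIV. F (Some k))"
  by (simp add: UNIV_option_conv prod.reindex)

lemma sum_option:
  fixes F :: "'n::finite option \<Rightarrow> 'a::comm_monoid_add"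
  shows "(\<Sum>k\<in>UNIV. F k) = F None + (\<Sum>k\<in>UNIV. F (Some k))"
  by (simp add: UNIV_option_conv sum.reindex)

text \<open>
  The half-open unit cube starts at the origin and moves along the diagonal; this is the set that
  it covers in space-time during the unit interval.
\<close>

definition tube_indicator :: "real ^ 'n \<Rightarrow> real \<Rightarrow> real" where
  "tube_indicator y t = of_bool (0 \<le> t \<and> t < 1) * (\<Prod>k\<in>UNIV. of_bool (t \<le> y $ k \<and> y $ k < t + 1))"

text \<open>
  Each factor of the tube indicator is a difference of two half-line indicators, belonging to
  \<open>e = 0\<close> and \<open>e = 1\<close>; the index \<open>None\<close> carries the factor in
  \<open>t\<close> alone.  Multiplying out gives one term for every binary vector.  The factors are
  half-open because only then is the identity valid at every point.
\<close>

lemma tube_indicator_expansion: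
  fixes y :: "real ^ 'n"
  shows "tube_indicator y t = (\<Sum>\<epsilon>\<in>binary_vectors. (- 1) ^ (\<Sum>k\<in>UNIV. \<epsilon> $ k) *
     (of_bool (real (\<epsilon> $ None) \<le> t) * (\<Prod>k\<in>UNIV. of_bool (t \<le> y $ k - real (\<epsilon> $ Some k)))))"
proof -
  define F :: "'n option \<Rightarrow> nat \<Rightarrow> real" where
    "F k e = (- 1) ^ e * (case k of None \<Rightarrow> of_bool (real e \<le> t) | Some j \<Rightarrow> of_bool (t \<le> y $ j - real e))"
    for k e
  have "tube_indicator y t = (\<Prod>k\<in>UNIV. F k 0 + F k 1)"
    unfolding tube_indicator_def prod_option
    by (intro arg_cong2[of _ _ _ _ "(*)"] prod.cong) (auto simp: F_def)
  also have "\<dots> = (\<Sum>\<epsilon>\<in>binary_vectors. \<Prod>k\<in>UNIV. F k (\<epsilon> $ k))"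
    by (rule sum_binary_vectors[symmetric])
  also have "\<dots> = (\<Sum>\<epsilon>\<in>binary_vectors. (- 1) ^ (\<Sum>k\<in>UNIV. \<epsilon> $ k) *
     (of_bool (real (\<epsilon> $ None) \<le> t) * (\<Prod>k\<in>UNIV. of_bool (t \<le> y $ k - real (\<epsilon> $ Some k)))))"
    unfolding F_def prod.distrib power_sum
    by (intro sum.cong refl arg_cong2[of _ _ _ _ "(*)"]) (subst prod_option, simp)
  finally show ?thesis .
qed

text \<open>
  The right-hand side of the formula in the coordinates \<open>y = \<Xi>\<^sup>-\<^sup>1 x\<close>, that is,
  for the standard basis as direction vectors.
\<close>

definition cube_spline :: "real ^ 'n \<Rightarrow> real" where
  "cube_spline y = (\<Sum>\<epsilon>\<in>binary_vectors. (- 1) ^ (\<Sum>k\<in>UNIV. \<epsilon> $ k) *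
     min_plus (\<chi> k. y $ k - real (\<epsilon> $ Some k) - real (\<epsilon> $ None)))"

text \<open>
  Geometrically, \<open>cube_spline y\<close> is the time during which the moving unit cube contains
  \<open>y\<close>: the convolution of the unit cube with the diagonal segment.  The term of a binary
  vector in the expanded tube indicator integrates to the positive part of a minimum.
\<close>

lemma has_bochner_integral_tube:
  "has_bochner_integral lborel (tube_indicator y) (cube_spline y)"
  unfolding tube_indicator_expansion[abs_def] cube_spline_def
  by (intro has_bochner_integral_sum has_bochner_integral_mult_right)
     (use has_bochner_integral_min_plus[of "real (\<epsilon> $ None)" "\<chi> k. y $ k - real (\<epsilon> $ Some k)" for \<epsilon>] in simp)

lemma continuous_on_Min_image:
  fixes f :: "'i \<Rightarrow> 'a::topological_space \<Rightarrow> real"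
  assumes "finite I" "I \<noteq> {}" "\<And>i. i \<in> I \<Longrightarrow> continuous_on S (f i)"
  shows "continuous_on S (\<lambda>x. Min ((\<lambda>i. f i x) ` I))"
  using assms by (induction rule: finite_ne_induct) (auto intro!: continuous_intros)

lemma continuous_on_cube_spline: "continuous_on UNIV (cube_spline :: real ^ 'n \<Rightarrow> real)"
  unfolding cube_spline_def[abs_def] min_plus_def vec_lambda_beta
  by (intro continuous_intros continuous_on_Min_image) auto

lemma cube_spline_support:
  assumes "cube_spline y \<noteq> 0"
  shows "y \<in> cbox 0 (\<chi> k. 2)"
proof (rule ccontr)
  assume "y \<notin> cbox 0 (\<chi> k. 2)"
  then obtain k where k: "y $ k < 0 \<or> 2 < y $ k"
    by (auto simp: mem_box_cart not_le)
  have "tube_indicator y t = 0" for t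
  proof -
    have "\<not> (0 \<le> t \<and> t < 1 \<and> t \<le> y $ k \<and> y $ k < t + 1)"
      using k by linarith
    then show ?thesis
      by (auto simp: tube_indicator_def prod_of_bool)
  qed
  then have "tube_indicator y = (\<lambda>_. 0)"
    by (rule ext)
  then show False
    using has_bochner_integral_integral_eq[OF has_bochner_integral_tube[of y]] assms by simp
qed

lemma has_bochner_integral_exp_unit_interval:
  fixes a t :: real
  defines "f \<equiv> \<lambda>s. of_bool (t \<le> s \<and> s < t + 1) * exp (- \<i> * complex_of_real (a * s))"
  shows "has_bochner_integral lborel f (exp (- \<i> * complex_of_real (a * t)) * box_factor a)"
proof -
  define F where "F s = (if a = 0 then complex_of_real s else exp (- \<i> * complex_of_real (a * s)) / (- \<i> * complex_of_real a))" for s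
  have "has_bochner_integral lborel (\<lambda>s. indicator {t..t+1} s *\<^sub>R exp (- \<i> * complex_of_real (a * s))) (F (t + 1) - F t)"
  proof (rule has_bochner_integral_FTC_Icc)
    show "(F has_vector_derivative exp (- \<i> * complex_of_real (a * s))) (at s within {t..t+1})" for s
    proof (cases "a = 0")
      case True
      then show ?thesis
        unfolding F_def by (auto intro!: derivative_eq_intros)
    next
      case False
      have "((\<lambda>z. exp (- \<i> * (complex_of_real a * z)) / (- \<i> * complex_of_real a)) has_field_derivative
          exp (- \<i> * (complex_of_real a * complex_of_real s))) (at (complex_of_real s))"
        using False by (auto intro!: derivative_eq_intros simp: algebra_simps)
      from has_vector_derivative_real_field[OF this] show ?thesis
        unfolding F_def using False by (simp add: has_vector_derivative_at_within o_def)
    qed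
  qed (auto intro!: continuous_intros)
  also have "F (t + 1) - F t = exp (- \<i> * complex_of_real (a * t)) * box_factor a"
    by (auto simp: F_def box_factor_def field_simps exp_diff exp_minus exp_add)
  finally have *: "has_bochner_integral lborel (\<lambda>s. indicator {t..t+1} s *\<^sub>R exp (- \<i> * complex_of_real (a * s)))
     (exp (- \<i> * complex_of_real (a * t)) * box_factor a)" .
  have [measurable]: "f \<in> borel_measurable lborel"
    unfolding f_def by measurable
  \<comment> \<open>The half-open interval differs from the closed one by a null set.\<close>
  show ?thesis
  proof (rule has_bochner_integralI_AE[OF *, rotated])
    show "AE s in lborel. indicator {t..t+1} s *\<^sub>R exp (- \<i> * complex_of_real (a * s)) = f s"
      using AE_lborel_singleton[of "t + 1"] by eventually_elim (auto simp: f_def indicator_def)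
  qed measurable
qed

text \<open>
  Lebesgue measure on vectors is the image of a product measure that is indexed by the basis
  vectors; translating basis vectors into indices turns the integral of a product into a product
  of integrals.
\<close>

lemma integral_lborel_vec_prod:
  fixes g :: "'n::finite \<Rightarrow> real \<Rightarrow> complex"
  assumes "\<And>k. integrable lborel (g k)"
  shows "(LINT y|lborel. (\<Prod>k\<in>UNIV. g k ((y :: real ^ 'n) $ k))) = (\<Prod>k\<in>UNIV. (LINT s|lborel. g k s))"
proof -
  interpret product_sigma_finite "\<lambda>_ :: real ^ 'n. lborel :: real measure"
    by standard
  have [measurable]: "g k \<in> borel_measurable borel" for k
    using borel_measurable_integrable[OF assms[of k]] by simp
  have Basis: "(Basis :: (real ^ 'n) set) = range (\<lambda>k. axis k 1)"
    by (auto simp: Basis_vec_def)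
  have inj: "inj (\<lambda>k :: 'n. axis k (1 :: real))"
    by (auto simp: inj_on_def axis_eq_axis)
  define idx :: "real ^ 'n \<Rightarrow> 'n" where "idx = inv (\<lambda>k. axis k 1)"
  have idx [simp]: "idx (axis k 1) = k" for k
    unfolding idx_def by (rule inv_f_f[OF inj])
  have nth [measurable]: "(\<lambda>y :: real ^ 'n. y $ k) \<in> borel_measurable borel" for k
    by (intro borel_measurable_continuous_onI continuous_intros)
  have comp: "(\<Sum>b\<in>Basis. f b *\<^sub>R b) $ k = f (axis k 1)" for f :: "real ^ 'n \<Rightarrow> real" and k
    unfolding Basis sum.reindex[OF inj] o_def sum_component
    by (simp add: axis_def if_distrib cong: if_cong)
  have "(LINT y|lborel. (\<Prod>k\<in>UNIV. g k ((y :: real ^ 'n) $ k)))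
      = (LINT f|(\<Pi>\<^sub>M b\<in>(Basis :: (real ^ 'n) set). lborel). (\<Prod>k\<in>UNIV. g k (f (axis k 1))))"
    by (subst lborel_eq, subst integral_distr) (simp_all add: comp del: sum_component)
  also have "\<dots> = (LINT f|(\<Pi>\<^sub>M b\<in>(Basis :: (real ^ 'n) set). lborel). (\<Prod>b\<in>Basis. g (idx b) (f b)))"
    unfolding Basis by (simp add: prod.reindex[OF inj])
  also have "\<dots> = (\<Prod>b\<in>(Basis :: (real ^ 'n) set). (LINT s|lborel. g (idx b) s))"
    by (rule product_integral_prod) (auto simp: assms)
  also have "\<dots> = (\<Prod>k\<in>UNIV. (LINT s|lborel. g k s))"
    unfolding Basis by (simp add: prod.reindex[OF inj])
  finally show ?thesis .
qed

text \<open>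
  Since the spline is a convolution, its transform factors: by Fubini's theorem one may integrate
  over \<open>y\<close> first, which gives the transform of the translated cube, equal to
  \<open>exp (- \<i> t (\<Sum>k. \<eta>\<^sub>k))\<close> times the product of the factors of the coordinate
  directions.  The remaining integral over \<open>t\<close> is the factor of the diagonal.
\<close>

lemma fourier_transform_cube_spline:
  fixes \<eta> :: "real ^ 'n"
  shows "fourier_transform cube_spline \<eta> = box_factor (\<Sum>k\<in>UNIV. \<eta> $ k) * (\<Prod>k\<in>UNIV. box_factor (\<eta> $ k))"
proof -
  define e where "e y = exp (- \<i> * complex_of_real (\<eta> \<bullet> y))" for y
  define f where "f y t = complex_of_real (tube_indicator y t) * e y" for y t
  have nth [measurable]: "(\<lambda>y :: real ^ 'n. y $ k) \<in> borel_measurable borel" for k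
    by (intro borel_measurable_continuous_onI continuous_intros)
  have e_meas [measurable]: "e \<in> borel_measurable borel"
    unfolding e_def by measurable
  have meas: "case_prod f \<in> borel_measurable (lborel \<Otimes>\<^sub>M lborel)"
    unfolding f_def tube_indicator_def by measurable
  have int: "integrable (lborel \<Otimes>\<^sub>M lborel) (case_prod f)"
  proof (rule integrableI_bounded_set[where A = "cbox (0, 0) (\<chi> k. 2, 1)" and B = 1])
    have "norm (tube_indicator y t) \<le> 1" for y :: "real ^ 'n" and t
      by (simp add: tube_indicator_def prod_of_bool)
    then show "AE z in lborel \<Otimes>\<^sub>M lborel. z \<in> cbox (0, 0) (\<chi> k. 2, 1) \<longrightarrow> norm (case_prod f z) \<le> 1"
      by (intro AE_I2) (auto simp: f_def e_def norm_mult)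
    show "emeasure (lborel \<Otimes>\<^sub>M lborel) (cbox (0 :: real ^ 'n, 0 :: real) (\<chi> k. 2, 1)) < \<infinity>"
      unfolding lborel_prod by (rule emeasure_bounded_finite) simp
    have "f y t = 0" if "(y, t) \<notin> cbox (0, 0) (\<chi> k. 2, 1)" for y t
    proof -
      have "\<not> (0 \<le> t \<and> t < 1 \<and> (\<forall>k. t \<le> y $ k \<and> y $ k < t + 1))"
      proof
        assume t: "0 \<le> t \<and> t < 1 \<and> (\<forall>k. t \<le> y $ k \<and> y $ k < t + 1)"
        have "0 \<le> y $ k \<and> y $ k \<le> 2" for k
          using t[THEN conjunct2, THEN conjunct2, rule_format, of k] t by linarith
        with t that show False
          by (simp add: cbox_Pair_eq mem_box_cart)
      qed
      then show ?thesis
        by (auto simp: f_def tube_indicator_def prod_of_bool)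
    qed
    then show "AE z in lborel \<Otimes>\<^sub>M lborel. z \<notin> cbox (0, 0) (\<chi> k. 2, 1) \<longrightarrow> case_prod f z = 0"
      by (intro AE_I2 impI) (metis case_prod_conv surj_pair)
    show "cbox (0, 0) (\<chi> k. 2, 1) \<in> sets (lborel \<Otimes>\<^sub>M lborel)"
      unfolding lborel_prod by simp
  qed (use meas in simp_all)
  have inner: "(LINT y|lborel. f y t) = of_bool (0 \<le> t \<and> t < 0 + 1) * exp (- \<i> * complex_of_real ((\<Sum>k\<in>UNIV. \<eta> $ k) * t)) *
      (\<Prod>k\<in>UNIV. box_factor (\<eta> $ k))" for t
  proof -
    define g where "g k s = of_bool (t \<le> s \<and> s < t + 1) * exp (- \<i> * complex_of_real (\<eta> $ k * s))" for k :: 'n and s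
    note g = has_bochner_integral_exp_unit_interval[of t "\<eta> $ k" for k, folded g_def]
    have "e y = (\<Prod>k\<in>UNIV. exp (- \<i> * complex_of_real (\<eta> $ k * y $ k)))" for y
      by (simp add: e_def inner_vec_def exp_sum[symmetric] sum_distrib_left sum_negf)
    moreover have of_real_of_bool: "complex_of_real (of_bool P) = of_bool P" for P
      by simp
    ultimately have "f y t = of_bool (0 \<le> t \<and> t < 0 + 1) * (\<Prod>k\<in>UNIV. g k (y $ k))" for y
      by (simp add: f_def tube_indicator_def g_def prod.distrib of_real_of_bool)
    then have "(LINT y|lborel. f y t) = of_bool (0 \<le> t \<and> t < 0 + 1) * (\<Prod>k\<in>UNIV. (LINT s|lborel. g k s))"
      using g by (simp add: integral_lborel_vec_prod has_bochner_integral_iff)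
    also have "(\<Prod>k\<in>UNIV. (LINT s|lborel. g k s)) = (\<Prod>k\<in>UNIV. exp (- \<i> * complex_of_real (\<eta> $ k * t)) * box_factor (\<eta> $ k))"
      using g by (simp add: has_bochner_integral_iff)
    also have "\<dots> = exp (- \<i> * complex_of_real ((\<Sum>k\<in>UNIV. \<eta> $ k) * t)) * (\<Prod>k\<in>UNIV. box_factor (\<eta> $ k))"
      by (simp add: prod.distrib exp_sum[symmetric] sum_distrib_left sum_distrib_right sum_negf)
    finally show ?thesis
      by simp
  qed
  have tube: "(LINT t|lborel. tube_indicator y t) = cube_spline y" for y :: "real ^ 'n"
    by (rule has_bochner_integral_integral_eq[OF has_bochner_integral_tube])
  have "fourier_transform cube_spline \<eta> = (LINT y|lborel. (LINT t|lborel. f y t))"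
    unfolding fourier_transform_def f_def e_def[symmetric]
    by (simp add: tube)
  also have "\<dots> = (LINT t|lborel. (LINT y|lborel. f y t))"
    by (rule lborel_pair.Fubini_integral[OF int, symmetric])
  also have "\<dots> = box_factor (\<Sum>k\<in>UNIV. \<eta> $ k) * (\<Prod>k\<in>UNIV. box_factor (\<eta> $ k))"
    unfolding inner using has_bochner_integral_exp_unit_interval[of 0 "\<Sum>k\<in>UNIV. \<eta> $ k"]
    by (simp add: has_bochner_integral_iff)
  finally show ?thesis .
qed

section \<open>The formula for the linear box spline\<close>

lemma matrix_inv_mult_vector:
  fixes A :: "'a::semiring_1 ^ 'n ^ 'm"
  assumes "invertible A"
  shows "A *v (matrix_inv A *v x) = x" and "matrix_inv A *v (A *v y) = y"
proof -
  have "A ** matrix_inv A = mat 1 \<and> matrix_inv A ** A = mat 1"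
    using assms unfolding invertible_def matrix_inv_def by (rule someI_ex)
  then show "A *v (matrix_inv A *v x) = x" "matrix_inv A *v (A *v y) = y"
    by (simp_all add: matrix_vector_mul_assoc)
qed

lemma invertible_matrix_of_columns:
  fixes \<xi> :: "'n::finite \<Rightarrow> real ^ 'n"
  assumes "inj \<xi>" and "independent (range \<xi>)"
  shows "invertible (matrix_of_columns \<xi>)"
proof -
  have "c i = 0" if "(\<Sum>i\<in>UNIV. c i *s column i (matrix_of_columns \<xi>)) = 0" for c i
  proof -
    have "(\<Sum>v\<in>range \<xi>. c (inv \<xi> v) *\<^sub>R v) = 0"
      using that by (simp add: sum.reindex[OF assms(1)] scalar_mult_eq_scaleR inv_f_f[OF assms(1)])
    from real_vector.independentD[OF assms(2) _ subset_refl this, of "\<xi> i"] show ?thesis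
      by (simp add: inv_f_f[OF assms(1)])
  qed
  then have "\<exists>B. B ** matrix_of_columns \<xi> = mat 1"
    unfolding matrix_left_invertible_independent_columns by blast
  then show ?thesis
    by (simp add: invertible_left_inverse)
qed

text \<open>
  The sum of the given vectors is the image of \<open>(1, ..., 1)\<close>, so the coefficient of the
  additional direction is added to every coordinate.
\<close>

lemma append_sum_mult:
  fixes \<xi> :: "'n::finite \<Rightarrow> real ^ 'n"
  shows "matrix_of_columns (append_sum \<xi>) *v v = matrix_of_columns \<xi> *v (\<chi> k. v $ Some k + v $ None)"
  by (simp add: matrix_vector_mult_def matrix_of_columns_def append_sum_def sum_option vec_eq_iff
      sum_distrib_left sum_distrib_right ring_distribs sum.distrib)

lemma inner_matrix_of_columns:
  fixes \<xi> :: "'n::finite \<Rightarrow> real ^ 'n"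
  shows "\<omega> \<bullet> (matrix_of_columns \<xi> *v y) = (\<chi> k. \<xi> k \<bullet> \<omega>) \<bullet> y"
  unfolding matrix_mult_sum inner_sum_right inner_vec_def[of "vec_lambda _" y]
  by (simp add: scalar_mult_eq_scaleR inner_commute mult.commute)

text \<open>
  The substitution \<open>x = \<Xi> y\<close> produces the factor \<open>\<bar>det \<Xi>\<bar>\<close> and turns
  the frequency \<open>\<omega>\<close> into the vector with the entries
  \<open>\<xi>\<^sub>k \<bullet> \<omega>\<close>, whose sum is the frequency in the additional direction.
\<close>

lemma is_linear_box_spline_cube_spline:
  fixes \<xi> :: "'n::finite \<Rightarrow> real ^ 'n"
  assumes "invertible (matrix_of_columns \<xi>)"
  shows "is_linear_box_spline \<xi> (\<lambda>x. cube_spline (matrix_inv (matrix_of_columns \<xi>) *v x))"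
proof -
  let ?M = "matrix_of_columns \<xi>" and ?G = "\<lambda>x. cube_spline (matrix_inv (matrix_of_columns \<xi>) *v x)"
  note MN = matrix_inv_mult_vector(1)[OF assms] and NM = matrix_inv_mult_vector(2)[OF assms]
  have cont: "continuous_on UNIV ?G"
    by (rule continuous_on_compose2[OF continuous_on_cube_spline])
       (auto intro!: linear_continuous_on matrix_vector_mul_bounded_linear)
  have "{x. ?G x \<noteq> 0} \<subseteq> (*v) ?M ` cbox 0 (\<chi> k. 2)"
    using cube_spline_support MN by (metis (mono_tags, lifting) image_eqI mem_Collect_eq subsetI)
  moreover have "bounded ((*v) ?M ` cbox 0 (\<chi> k. 2))"
    by (intro bounded_linear_image matrix_vector_mul_bounded_linear bounded_cbox)
  ultimately have supp: "bounded {x. ?G x \<noteq> 0}"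
    by (rule bounded_subset[rotated])
  have "fourier_transform ?G \<omega> = complex_of_real \<bar>det ?M\<bar> * (\<Prod>k\<in>UNIV. box_factor (append_sum \<xi> k \<bullet> \<omega>))" for \<omega>
  proof -
    have "fourier_transform ?G \<omega> = complex_of_real \<bar>det ?M\<bar> *
        (LINT y|lborel. complex_of_real (?G (?M *v y)) * exp (- \<i> * complex_of_real (\<omega> \<bullet> (?M *v y))))"
      unfolding fourier_transform_def using cont
      by (intro integral_lborel_linear assms borel_measurable_continuous_onI continuous_intros)
    also have "\<dots> = complex_of_real \<bar>det ?M\<bar> * fourier_transform cube_spline (\<chi> k. \<xi> k \<bullet> \<omega>)"
      by (simp add: NM fourier_transform_def inner_matrix_of_columns)
    also have "\<dots> = complex_of_real \<bar>det ?M\<bar> * (\<Prod>k\<in>UNIV. box_factor (append_sum \<xi> k \<bullet> \<omega>))"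
      by (simp add: fourier_transform_cube_spline prod_option append_sum_def inner_sum_left)
    finally show ?thesis .
  qed
  then show ?thesis
    using cont supp by (simp add: is_linear_box_spline_def)
qed

lemma is_linear_box_spline_unique:
  assumes "is_linear_box_spline \<xi> B" and "is_linear_box_spline \<xi> C"
  shows "B = C"
proof
  fix x
  have B: "continuous_on UNIV B" "bounded {x. B x \<noteq> 0}" and C: "continuous_on UNIV C" "bounded {x. C x \<noteq> 0}"
    and eq: "\<And>\<omega>. fourier_transform B \<omega> = fourier_transform C \<omega>"
    using assms by (auto simp: is_linear_box_spline_def)
  have C': "continuous_on UNIV (\<lambda>x. - 1 * C x)" "bounded {x. - 1 * C x \<noteq> 0}"
    using C by (auto intro!: continuous_intros)
  have "fourier_transform (\<lambda>x. B x + - 1 * C x) \<omega> = 0" for \<omega>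
    unfolding fourier_transform_add[OF B C'] fourier_transform_cmult by (simp add: eq)
  moreover have "bounded {x. B x + - 1 * C x \<noteq> 0}"
    by (rule bounded_support_add[OF B(2) C'(2)])
  ultimately have "fourier_null (\<lambda>x. B x + - 1 * C x)"
    unfolding fourier_null_def using continuous_on_add[OF B(1) C'(1)] by blast
  from fourier_null_imp_zero[OF this, of x] show "B x = C x"
    by simp
qed

theorem proposition4:
  fixes \<xi> :: "'n::finite \<Rightarrow> real ^ 'n" and x :: "real ^ 'n"
  assumes "inj \<xi>" and "independent (range \<xi>)"
  shows "linear_box_spline \<xi> x =
    (\<Sum>\<epsilon>\<in>binary_vectors. (- 1) ^ (\<Sum>k\<in>UNIV. \<epsilon> $ k) *
       min_plus (matrix_inv (matrix_of_columns \<xi>) *v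
         (x - matrix_of_columns (append_sum \<xi>) *v (\<chi> k. real (\<epsilon> $ k)))))"
proof -
  let ?M = "matrix_of_columns \<xi>"
  have inv: "invertible ?M"
    using assms by (rule invertible_matrix_of_columns)
  note NM = matrix_inv_mult_vector(2)[OF inv]
  have "linear_box_spline \<xi> = (\<lambda>x. cube_spline (matrix_inv ?M *v x))"
    unfolding linear_box_spline_def
    using is_linear_box_spline_cube_spline[OF inv] is_linear_box_spline_unique
    by (intro the_equality)
  moreover have "matrix_inv ?M *v (x - matrix_of_columns (append_sum \<xi>) *v (\<chi> k. real (\<epsilon> $ k)))
      = (\<chi> k. (matrix_inv ?M *v x) $ k - real (\<epsilon> $ Some k) - real (\<epsilon> $ None))" for \<epsilon> :: "nat ^ 'n option"
    by (simp add: append_sum_mult matrix_vector_mult_diff_distrib NM vec_eq_iff)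
  ultimately show ?thesis
    by (simp add: cube_spline_def)
qed

end
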